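(* Let $p$ be a prime and $r\ge 1$ an integer. A free convolutional code $\mathcal{C}$ over $\mathbb{Z}_{p^r}$ is catastrophic if and only if its dual $\mathcal{C}^\perp$ is catastrophic.
   Context: $\mathbb{Z}_{p^r}=\mathbb{Z}/p^r\mathbb{Z}$, and $\mathbb{Z}_{p^r}((D))$ is the ring of formal Laurent series in $D$ (finitely many negative powers of $D$). A free convolutional code $\mathcal{C}$ of length $n$ and rank $k$ over $\mathbb{Z}_{p^r}$ is a free submodule of $\mathbb{Z}_{p^r}((D))^n$ of rank $k$ generated by the rows of a $k\times n$ polynomial matrix $G(D)\in\mathbb{Z}_{p^r}[D]^{k\times n}$ of full rank (rows linearly independent over $\mathbb{Z}_{p^r}((D))$), i.e. $\mathcal{C}=\{\mathbf{u}(D)G(D) : \mathbf{u}(D)\in\mathbb{Z}_{p^r}((D))^k\}$. Such a $G(D)$ is called a generator matrix (or encoder) of $\mathcal{C}$. The dual code of $\mathcal{C}$ is $\mathcal{C}^\perp=\{\mathbf{v}(D)\in\mathbb{Z}_{p^r}((D))^n : \mathbf{v}(D)\cdot\mathbf{w}(D)^T=0 \text{ for all } \mathbf{w}(D)\in\mathcal{C}\}$; it is a known fact that it is a free convolutional code of length $n$ and rank $n-k$, so it admits a polynomial generator matrix $H(D)\in\mathbb{Z}_{p^r}[D]^{(n-k)\times n}$. The Hamming weight of $\mathbf{u}(D)=(u_1(D),\dots,u_m(D))\in\mathbb{Z}_{p^r}((D))^m$ is $\mathrm{wt}[\mathbf{u}(D)]=\sum_i \mathrm{wt}[u_i(D)]$,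 where $\mathrm{wt}[u_i(D)]$ is the (possibly infinite) number of nonzero coefficients of $u_i(D)$. A generator matrix $G(D)\in\mathbb{Z}_{p^r}[D]^{k\times n}$ is non-catastrophic if for all $\mathbf{u}(D)\in\mathbb{Z}_{p^r}((D))^k$: $\mathrm{wt}[\mathbf{u}(D)G(D)]<\infty \iff \mathrm{wt}[\mathbf{u}(D)]<\infty$; otherwise it is catastrophic. A code is catastrophic if every polynomial generator matrix of it is catastrophic. *)

theory Defs
  imports
    "HOL-Library.Extended_Nat"
    "HOL-Computational_Algebra.Polynomial_FPS"
    "HOL-Computational_Algebra.Formal_Laurent_Series"
    "Jordan_Normal_Form.Matrix"
    "Berlekamp_Zassenhaus.Finite_Field"
begin

text \<open>
  The ring of integers modulo $p^r$ is the type \<open>'a mod_ring\<close> with \<open>CARD('a) = p ^ r\<close>.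
  The definitions below are stated over an arbitrary commutative ring. Vectors and matrices have
  their dimensions as natural numbers, so codes of rank \<open>0\<close> and \<open>n\<close> are included.
\<close>

definition laurent_mat :: "'a::comm_ring_1 poly mat \<Rightarrow> 'a fls mat" where
  "laurent_mat G = map_mat (\<lambda>q. fps_to_fls (fps_of_poly q)) G"

text \<open>The row vector $u\,G$, written as the column vector $G^T u^T$.\<close>

definition encode :: "'a::comm_ring_1 poly mat \<Rightarrow> 'a fls vec \<Rightarrow> 'a fls vec" where
  "encode G u = transpose_mat (laurent_mat G) *\<^sub>v u"

definition full_rank :: "nat \<Rightarrow> 'a::comm_ring_1 poly mat \<Rightarrow> bool" where
  "full_rank n G \<longleftrightarrow>
     (\<forall>u \<in> carrier_vec (dim_row G). encode G u = 0\<^sub>v n \<longrightarrow> u = 0\<^sub>v (dim_row G))"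

definition generator_matrix ::
  "nat \<Rightarrow> nat \<Rightarrow> 'a::comm_ring_1 poly mat \<Rightarrow> 'a fls vec set \<Rightarrow> bool" where
  "generator_matrix n k G C \<longleftrightarrow>
     G \<in> carrier_mat k n \<and> full_rank n G \<and> C = encode G ` carrier_vec k"

definition free_conv_code :: "nat \<Rightarrow> nat \<Rightarrow> 'a::comm_ring_1 fls vec set \<Rightarrow> bool" where
  "free_conv_code n k C \<longleftrightarrow> (\<exists>G. generator_matrix n k G C)"

definition dual_code :: "nat \<Rightarrow> 'a::comm_ring_1 fls vec set \<Rightarrow> 'a fls vec set" where
  "dual_code n C = {v \<in> carrier_vec n. \<forall>w \<in> C. v \<bullet> w = 0}"

definition wt_fls :: "'a::zero fls \<Rightarrow> enat" where
  "wt_fls f = (if finite {i. fls_nth f i \<noteq> 0} then enat (card {i. fls_nth f i \<noteq> 0}) else \<infinity>)"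

definition wt_vec :: "'a::zero fls vec \<Rightarrow> enat" where
  "wt_vec v = (\<Sum>i<dim_vec v. wt_fls (v $ i))"

definition non_catastrophic :: "'a::comm_ring_1 poly mat \<Rightarrow> bool" where
  "non_catastrophic G \<longleftrightarrow>
     (\<forall>u \<in> carrier_vec (dim_row G). wt_vec (encode G u) < \<infinity> \<longleftrightarrow> wt_vec u < \<infinity>)"

text \<open>
  The number of rows \<open>k\<close> is quantified here, but over a nontrivial commutative ring it is determined
  by \<open>C\<close>: it is the rank of \<open>C\<close>.
\<close>

definition catastrophic_code :: "nat \<Rightarrow> 'a::comm_ring_1 fls vec set \<Rightarrow> bool" where
  "catastrophic_code n C \<longleftrightarrow> (\<forall>k G. generator_matrix n k G C \<longrightarrow> \<not> non_catastrophic G)"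

end

theory Submission
  imports Defs
begin

text \<open>
  Over the Laurent polynomials \<open>L\<close>, the condition that \<open>u G\<close> finite implies \<open>u\<close> finite, together with full
  rank, forces \<open>G\<close>, reduced modulo \<open>p\<close>, to have only units as invariant factors. As \<open>p\<close> is nilpotent, column
  operations over \<open>L\<close> then bring \<open>G\<close> itself to the form \<open>(I 0)\<close>; that is, \<open>G\<close> consists of the first rows
  of an invertible matrix over \<open>L\<close>. The last columns of the inverse, multiplied by a power of \<open>D\<close>, are a
  non-catastrophic encoder of the dual code. The same elimination over all Laurent series, where
  every element that is nonzero modulo \<open>p\<close> is a unit, shows that a free code equals its double dual,
  which gives the converse implication.
\<close>


section \<open>Column reduction over a subring\<close>

definition mat_over :: "'s set \<Rightarrow> 's mat \<Rightarrow> bool" where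
  "mat_over A M \<longleftrightarrow> (\<forall>i<dim_row M. \<forall>j<dim_col M. M $$ (i,j) \<in> A)"

text \<open>The inverse is carried along, with entries in \<open>A\<close> as well, because both
  factors are needed: \<open>W\<close> extends an encoder to a square matrix and \<open>V\<close>
  supplies an encoder of the dual.\<close>

definition unimodular_pair :: "'s::comm_ring_1 set \<Rightarrow> nat \<Rightarrow> 's mat \<Rightarrow> 's mat \<Rightarrow> bool" where
  "unimodular_pair A n V W \<longleftrightarrow>
     V \<in> carrier_mat n n \<and> W \<in> carrier_mat n n \<and> mat_over A V \<and> mat_over A W \<and>
     V * W = 1\<^sub>m n \<and> W * V = 1\<^sub>m n"

definition col_equiv :: "'s::comm_ring_1 set \<Rightarrow> nat \<Rightarrow> 's mat \<Rightarrow> 's mat \<Rightarrow> bool" where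
  "col_equiv A n G G' \<longleftrightarrow> (\<exists>V W. unimodular_pair A n V W \<and> G' = G * V)"

definition independent_rows :: "'s::comm_ring_1 mat \<Rightarrow> bool" where
  "independent_rows G \<longleftrightarrow>
     (\<forall>u \<in> carrier_vec (dim_row G).
        transpose_mat G *\<^sub>v u = 0\<^sub>v (dim_col G) \<longrightarrow> u = 0\<^sub>v (dim_row G))"

text \<open>Here \<open>u\<close> ranges over the whole ambient ring. For Laurent polynomials inside
  Laurent series this says that finite weight of \<open>u G\<close> forces finite weight of
  \<open>u\<close>.\<close>

definition primitive_rows :: "'s::comm_ring_1 set \<Rightarrow> 's mat \<Rightarrow> bool" where
  "primitive_rows A G \<longleftrightarrow>
     (\<forall>u \<in> carrier_vec (dim_row G).
        (\<forall>l<dim_col G. (transpose_mat G *\<^sub>v u) $ l \<in> A) \<longrightarrow> (\<forall>i<dim_row G. u $ i \<in> A))"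

definition unit_rows :: "nat \<Rightarrow> nat \<Rightarrow> 's::comm_ring_1 mat \<Rightarrow> bool" where
  "unit_rows j n G \<longleftrightarrow> (\<forall>i<j. \<forall>l<n. G $$ (i,l) = (if i = l then 1 else 0))"

text \<open>Right multiplication by this matrix scales column \<open>j\<close> by \<open>r j\<close>
  and adds \<open>r b\<close> times the old column \<open>j\<close> to every other column
  \<open>b\<close>. One shape thus covers both the Euclidean steps and the final clearing of a
  row.\<close>

definition row_rep :: "nat \<Rightarrow> nat \<Rightarrow> (nat \<Rightarrow> 's) \<Rightarrow> 's::comm_ring_1 mat" where
  "row_rep n j r = mat n n (\<lambda>(a,b). if a = j then r b else if a = b then 1 else 0)"

lemma row_rep_carrier [simp]: "row_rep n j r \<in> carrier_mat n n"
  by (simp add: row_rep_def)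

lemma mult_row_rep:
  assumes G: "G \<in> carrier_mat k n" and j: "j < n" and a: "a < k" and b: "b < n"
  shows "(G * row_rep n j r) $$ (a,b) = (if b = j then 0 else G $$ (a,b)) + G $$ (a,j) * r b"
proof -
  have "(G * row_rep n j r) $$ (a,b) =
      (\<Sum>l<n. G $$ (a,l) * (if l = j then r b else if l = b then 1 else 0))"
    using assms by (auto simp: row_rep_def scalar_prod_def atLeast0LessThan intro!: sum.cong)
  also have "\<dots> = (\<Sum>l<n. (if l = j then G $$ (a,j) * r b else 0) +
      (if l = b then (if b = j then 0 else G $$ (a,b)) else 0))"
    by (intro sum.cong) auto
  also have "\<dots> = (if b = j then 0 else G $$ (a,b)) + G $$ (a,j) * r b"
    using j b by (simp add: sum.distrib)
  finally show ?thesis .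
qed

text \<open>The shape is closed under products, so an inverse is found by solving for a single
  row.\<close>

lemma row_rep_mult_row_rep:
  assumes "j < n"
  shows "row_rep n j r * row_rep n j s = row_rep n j (\<lambda>b. (if b = j then 0 else r b) + r j * s b)"
proof (rule eq_matI)
  fix a b assume "a < dim_row (row_rep n j (\<lambda>b. (if b = j then 0 else r b) + r j * s b))"
    and "b < dim_col (row_rep n j (\<lambda>b. (if b = j then 0 else r b) + r j * s b))"
  then have ab: "a < n" "b < n" by (auto simp: row_rep_def)
  show "(row_rep n j r * row_rep n j s) $$ (a,b) =
      row_rep n j (\<lambda>b. (if b = j then 0 else r b) + r j * s b) $$ (a,b)"
    unfolding mult_row_rep[OF row_rep_carrier assms ab] using ab assms by (auto simp: row_rep_def)
qed (auto simp: row_rep_def)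

lemma row_rep_one: "row_rep n j (\<lambda>b. if b = j then 1 else 0) = 1\<^sub>m n"
  by (rule eq_matI) (auto simp: row_rep_def)

section \<open>Column equivalence over a subring\<close>

locale subring =
  fixes A :: "'s::comm_ring_1 set"
  assumes one_mem: "1 \<in> A"
    and diff_mem: "x \<in> A \<Longrightarrow> y \<in> A \<Longrightarrow> x - y \<in> A"
    and mult_mem: "x \<in> A \<Longrightarrow> y \<in> A \<Longrightarrow> x * y \<in> A"
begin

lemma zero_mem: "0 \<in> A"
  using diff_mem[OF one_mem one_mem] by simp

lemma uminus_mem: "x \<in> A \<Longrightarrow> - x \<in> A"
  using diff_mem[OF zero_mem] by fastforce

lemma add_mem: "x \<in> A \<Longrightarrow> y \<in> A \<Longrightarrow> x + y \<in> A"
  using diff_mem[OF _ uminus_mem] by fastforce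

lemma sum_mem: "(\<And>i. i \<in> I \<Longrightarrow> f i \<in> A) \<Longrightarrow> sum f I \<in> A"
  by (induction I rule: infinite_finite_induct) (auto simp: zero_mem add_mem)

lemma power_mem: "x \<in> A \<Longrightarrow> x ^ i \<in> A"
  by (induction i) (auto simp: one_mem mult_mem)

lemma mult_mat_over:
  assumes "mat_over A M" "mat_over A N" "dim_col M = dim_row N"
  shows "mat_over A (M * N)"
  using assms unfolding mat_over_def by (auto simp: scalar_prod_def intro!: sum_mem mult_mem)

lemma mult_mat_vec_mem:
  assumes "mat_over A M" "\<forall>i<dim_vec v. v $ i \<in> A" "dim_col M = dim_vec v" "i < dim_row M"
  shows "(M *\<^sub>v v) $ i \<in> A"
  using assms unfolding mat_over_def by (auto simp: scalar_prod_def intro!: sum_mem mult_mem)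

lemma col_equiv_refl:
  assumes "G \<in> carrier_mat k n" shows "col_equiv A n G G"
  unfolding col_equiv_def unimodular_pair_def
  using assms by (intro exI[of _ "1\<^sub>m n"]) (auto simp: mat_over_def one_mem zero_mem)

lemma col_equiv_trans:
  assumes G: "G \<in> carrier_mat k n" and "col_equiv A n G G'" and "col_equiv A n G' G''"
  shows "col_equiv A n G G''"
proof -
  obtain V W where VW: "unimodular_pair A n V W" "G' = G * V"
    using assms(2) by (auto simp: col_equiv_def)
  obtain V' W' where VW': "unimodular_pair A n V' W'" "G'' = G' * V'"
    using assms(3) by (auto simp: col_equiv_def)
  note c = VW(1)[unfolded unimodular_pair_def] VW'(1)[unfolded unimodular_pair_def]
  have cs [simp]: "V \<in> carrier_mat n n" "W \<in> carrier_mat n n" "V' \<in> carrier_mat n n" "W' \<in> carrier_mat n n"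
    using c by auto
  have "(V * V') * (W' * W) = V * (V' * (W' * W))" by (rule assoc_mult_mat[of _ n n _ n _ n]) (auto intro: mult_carrier_mat[of _ n n _ n])
  also have "V' * (W' * W) = (V' * W') * W" by (rule assoc_mult_mat[of _ n n _ n _ n, symmetric]) (auto intro: mult_carrier_mat[of _ n n _ n])
  finally have 1: "(V * V') * (W' * W) = 1\<^sub>m n" using c left_mult_one_mat[of W n n] by simp
  have "(W' * W) * (V * V') = W' * (W * (V * V'))" by (rule assoc_mult_mat[of _ n n _ n _ n]) (auto intro: mult_carrier_mat[of _ n n _ n])
  also have "W * (V * V') = (W * V) * V'" by (rule assoc_mult_mat[of _ n n _ n _ n, symmetric]) (auto intro: mult_carrier_mat[of _ n n _ n])
  finally have 2: "(W' * W) * (V * V') = 1\<^sub>m n" using c left_mult_one_mat[of V' n n] by simp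
  have 3: "mat_over A (V * V')" "mat_over A (W' * W)"
    using c cs[THEN carrier_matD(1)] cs[THEN carrier_matD(2)] by (auto intro!: mult_mat_over)
  have "G'' = G * (V * V')" unfolding VW' VW using G by (intro assoc_mult_mat[of _ k n _ n _ n]) auto
  then show ?thesis unfolding col_equiv_def unimodular_pair_def using 1 2 3
    by (intro exI[of _ "V * V'"] exI[of _ "W' * W"]) (simp add: mult_carrier_mat[of _ n n])
qed

lemma col_equiv_carrier:
  "G \<in> carrier_mat k n \<Longrightarrow> col_equiv A n G G' \<Longrightarrow> G' \<in> carrier_mat k n"
  by (auto simp: col_equiv_def unimodular_pair_def)

lemma col_equiv_mat_over:
  "G \<in> carrier_mat k n \<Longrightarrow> col_equiv A n G G' \<Longrightarrow> mat_over A G \<Longrightarrow> mat_over A G'"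
  by (auto simp: col_equiv_def unimodular_pair_def intro!: mult_mat_over)

lemma col_equiv_row_rep:
  assumes G: "G \<in> carrier_mat k n" and j: "j < n" and rA: "\<And>b. b < n \<Longrightarrow> r b \<in> A"
    and d: "d \<in> A" "r j * d = 1"
  shows "col_equiv A n G (G * row_rep n j r)"
proof -
  \<comment> \<open>Row \<open>j\<close> of the inverse: the solution of \<open>(if b = j then 0
    else r b) + r j * s b = (if b = j then 1 else 0)\<close>.\<close>
  define s where "s b = (if b = j then d else - (r b * d))" for b
  have dr: "d * (x * r j) = x" for x using d(2) by (metis mult.left_commute mult.commute mult_1_right)
  have 1: "row_rep n j r * row_rep n j s = 1\<^sub>m n"
    unfolding row_rep_mult_row_rep[OF j] row_rep_one[of n j, symmetric]
    using d by (intro arg_cong[where f = "row_rep n j"] ext) (auto simp: s_def dr algebra_simps)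
  have 2: "row_rep n j s * row_rep n j r = 1\<^sub>m n"
    unfolding row_rep_mult_row_rep[OF j] row_rep_one[of n j, symmetric]
    using d by (intro arg_cong[where f = "row_rep n j"] ext)
      (auto simp: s_def dr mult.commute[of d])
  have "mat_over A (row_rep n j r)" "mat_over A (row_rep n j s)"
    using rA d j by (auto simp: mat_over_def row_rep_def s_def one_mem zero_mem
        intro!: uminus_mem mult_mem)
  then show ?thesis unfolding col_equiv_def unimodular_pair_def using 1 2
    by (intro exI[of _ "row_rep n j r"] exI[of _ "row_rep n j s"]) auto
qed

lemma col_equiv_transpose_mult:
  fixes G :: "'s mat"
  assumes G: "G \<in> carrier_mat k n" and V: "V \<in> carrier_mat n n" and u: "u \<in> carrier_vec k"
  shows "transpose_mat (G * V) *\<^sub>v u = transpose_mat V *\<^sub>v (transpose_mat G *\<^sub>v u)"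
  using assms by (simp add: transpose_mult[of G k n V n] assoc_mult_mat_vec[of _ n n _ k])

lemma unimodular_pair_transpose_cancel:
  assumes "unimodular_pair A n V W" "x \<in> carrier_vec n"
  shows "transpose_mat W *\<^sub>v (transpose_mat V *\<^sub>v x) = x"
proof -
  have VW: "V \<in> carrier_mat n n" "W \<in> carrier_mat n n" "V * W = 1\<^sub>m n"
    using assms by (auto simp: unimodular_pair_def)
  have "transpose_mat W *\<^sub>v (transpose_mat V *\<^sub>v x) = (transpose_mat W * transpose_mat V) *\<^sub>v x"
    using VW assms by (intro assoc_mult_mat_vec[symmetric]) auto
  also have "transpose_mat W * transpose_mat V = 1\<^sub>m n"
    using transpose_mult[OF VW(1,2)] VW by simp
  finally show ?thesis using assms by simp
qed

lemma col_equiv_independent_rows: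
  assumes G: "G \<in> carrier_mat k n" and e: "col_equiv A n G G'" and ind: "independent_rows G"
  shows "independent_rows G'"
proof -
  obtain V W where VW: "unimodular_pair A n V W" "G' = G * V"
    using e by (auto simp: col_equiv_def)
  have c: "V \<in> carrier_mat n n" "W \<in> carrier_mat n n" using VW by (auto simp: unimodular_pair_def)
  show ?thesis unfolding independent_rows_def
  proof (intro ballI impI)
    fix u assume u: "u \<in> carrier_vec (dim_row G')"
      and z: "transpose_mat G' *\<^sub>v u = 0\<^sub>v (dim_col G')"
    then have u': "u \<in> carrier_vec k" using G VW by auto
    have "transpose_mat G *\<^sub>v u = transpose_mat W *\<^sub>v (transpose_mat G' *\<^sub>v u)"
      unfolding VW(2) col_equiv_transpose_mult[OF G c(1) u']
      using G u' by (subst unimodular_pair_transpose_cancel[OF VW(1)]) auto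
    also have "\<dots> = 0\<^sub>v n" unfolding z using c G VW by auto
    finally show "u = 0\<^sub>v (dim_row G')" using ind u' G VW by (auto simp: independent_rows_def)
  qed
qed

text \<open>Column operations change \<open>u G\<close> but not \<open>u\<close>. The old product is
  recovered from the new one through \<open>W\<close>, whose entries lie in \<open>A\<close>, so
  membership in \<open>A\<close> carries over.\<close>

lemma col_equiv_primitive_rows:
  assumes G: "G \<in> carrier_mat k n" and e: "col_equiv A n G G'" and ind: "primitive_rows A G"
  shows "primitive_rows A G'"
proof -
  obtain V W where VW: "unimodular_pair A n V W" "G' = G * V"
    using e by (auto simp: col_equiv_def)
  have c: "V \<in> carrier_mat n n" "W \<in> carrier_mat n n" "mat_over A W"
    using VW by (auto simp: unimodular_pair_def)
  show ?thesis unfolding primitive_rows_def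
  proof (intro ballI impI)
    fix u assume u: "u \<in> carrier_vec (dim_row G')"
      and z: "\<forall>l<dim_col G'. (transpose_mat G' *\<^sub>v u) $ l \<in> A"
    then have u': "u \<in> carrier_vec k" using G VW by auto
    have eq: "transpose_mat G *\<^sub>v u = transpose_mat W *\<^sub>v (transpose_mat G' *\<^sub>v u)"
      unfolding VW(2) col_equiv_transpose_mult[OF G c(1) u']
      using G u' by (subst unimodular_pair_transpose_cancel[OF VW(1)]) auto
    have "(transpose_mat G *\<^sub>v u) $ l \<in> A" if "l < n" for l
      unfolding eq using c z that VW(2)
      by (intro mult_mat_vec_mem) (auto simp: mat_over_def)
    then show "\<forall>i<dim_row G'. u $ i \<in> A" using ind u' G VW by (auto simp: primitive_rows_def)
  qed
qed

end

section \<open>Elimination over a subring that is Euclidean modulo a nilpotent element\<close>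

text \<open>The ambient ring is local with nilpotent maximal ideal \<open>(c)\<close>; \<open>A\<close> need not be local, but is Euclidean
  modulo \<open>c\<close>, with size function \<open>sz\<close> (meaningful only modulo \<open>c\<close>).\<close>

locale local_euclidean_subring = subring A
  for A :: "'s::comm_ring_1 set" +
  fixes c :: 's and m :: nat and sz :: "'s \<Rightarrow> nat"
  assumes c_mem: "c \<in> A"
    and ann: "c ^ m * x = 0 \<longleftrightarrow> c dvd x"
    and unit: "\<not> c dvd x \<Longrightarrow> x dvd 1"
    and pure: "x \<in> A \<Longrightarrow> c dvd x \<Longrightarrow> \<exists>y\<in>A. x = c * y"
    and lift: "c ^ m * x \<in> A \<Longrightarrow> \<exists>y\<in>A. c dvd x - y"
    and euclid: "x \<in> A \<Longrightarrow> y \<in> A \<Longrightarrow> \<not> c dvd y \<Longrightarrow> \<exists>q\<in>A. sz (x - q * y) < sz y"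
begin

lemma not_c_dvd_1: "\<not> c dvd 1"
proof
  assume d: "c dvd 1"
  then have "c ^ m dvd 1" using dvd_power_same[OF d, of m] by simp
  moreover have "c ^ m * 1 = 0" using ann d by blast
  ultimately show False by auto
qed

lemma c_nilpotent: "c ^ Suc m = 0"
  using ann[of c] by (simp add: mult.commute)

text \<open>Adding multiples of columns from \<open>j\<close> on to one another runs Euclid's algorithm modulo \<open>c\<close>
  on the tail of row \<open>j\<close>.\<close>

lemma euclid_row:
  assumes "G \<in> carrier_mat k n" "mat_over A G" "j < k" "j < n" "unit_rows j n G"
  shows "\<exists>G'. col_equiv A n G G' \<and> unit_rows j n G' \<and> (\<forall>i. j < i \<longrightarrow> i < n \<longrightarrow> c dvd G' $$ (j,i))"
  using assms
proof (induction "\<Sum>i=j..<n. sz (G $$ (j,i))" arbitrary: G rule: less_induct)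
  case less
  note G = less.prems(1) and GA = less.prems(2) and j = less.prems(3,4) and ur = less.prems(5)
  \<comment> \<open>Adds \<open>q\<close> times column \<open>l\<close> to column \<open>i\<close>.
    Columns from \<open>j\<close> on vanish in the rows above \<open>j\<close>, so
    \<open>l \<ge> j\<close> keeps those rows unit vectors.\<close>
  let ?add = "\<lambda>G l i q. G * row_rep n l (\<lambda>b. if b = l then 1 else if b = i then q else 0)"
  have add: "col_equiv A n G (?add G l i q) \<and> unit_rows j n (?add G l i q) \<and>
     (\<forall>b<n. ?add G l i q $$ (j,b) = (if b = i then G $$ (j,i) + q * G $$ (j,l) else G $$ (j,b)))"
    if G: "G \<in> carrier_mat k n" and ur: "unit_rows j n G" and l: "l \<ge> j" "l < n" "i < n" "i \<noteq> l" "q \<in> A"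
    for i l q G
  proof (intro conjI allI impI)
    show "col_equiv A n G (?add G l i q)"
      by (rule col_equiv_row_rep[OF G l(2), where d = 1]) (use l in \<open>auto simp: one_mem zero_mem\<close>)
    show "unit_rows j n (?add G l i q)"
      using ur l less.prems(3,4) unfolding unit_rows_def by (auto simp: mult_row_rep[OF G l(2)])
    show "?add G l i q $$ (j,b) = (if b = i then G $$ (j,i) + q * G $$ (j,l) else G $$ (j,b))"
      if "b < n" for b
      using that l less.prems(3,4) by (auto simp: mult_row_rep[OF G l(2)])
  qed
  show ?case
  proof (cases "\<exists>l i. j \<le> l \<and> l < n \<and> j \<le> i \<and> i < n \<and> i \<noteq> l \<and> \<not> c dvd G $$ (j,l) \<and>
      sz (G $$ (j,l)) \<le> sz (G $$ (j,i))")
    case True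
    then obtain l i where li: "j \<le> l" "l < n" "j \<le> i" "i < n" "i \<noteq> l" "\<not> c dvd G $$ (j,l)"
      "sz (G $$ (j,l)) \<le> sz (G $$ (j,i))" by blast
    \<comment> \<open>Division replaces entry \<open>i\<close> by a remainder smaller than entry
      \<open>l\<close>, hence smaller than the old entry \<open>i\<close>; the total size of the
      tail drops.\<close>
    have mem: "G $$ (j,i) \<in> A" "G $$ (j,l) \<in> A"
      using GA G j li by (auto simp: mat_over_def)
    obtain q where q: "q \<in> A" "sz (G $$ (j,i) - q * G $$ (j,l)) < sz (G $$ (j,l))"
      using euclid[OF mem li(6)] by blast
    define G' where "G' = ?add G l i (- q)"
    have G': "col_equiv A n G G'" "unit_rows j n G'"
      "\<And>b. b < n \<Longrightarrow> G' $$ (j,b) = (if b = i then G $$ (j,i) - q * G $$ (j,l) else G $$ (j,b))"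
      using add[OF G ur li(1,2,4,5) uminus_mem[OF q(1)]] unfolding G'_def by auto
    have "(\<Sum>b=j..<n. sz (G' $$ (j,b))) < (\<Sum>b=j..<n. sz (G $$ (j,b)))"
    proof (rule sum_strict_mono_ex1)
      show "\<forall>b\<in>{j..<n}. sz (G' $$ (j, b)) \<le> sz (G $$ (j, b))"
        using q li G'(3) by auto
      show "\<exists>b\<in>{j..<n}. sz (G' $$ (j, b)) < sz (G $$ (j, b))"
        using q li G'(3)[of i] by (intro bexI[of _ i]) auto
    qed auto
    from less.hyps[OF this col_equiv_carrier[OF G G'(1)] col_equiv_mat_over[OF G G'(1) GA] j G'(2)]
    show ?thesis using col_equiv_trans[OF G G'(1)] by blast
  next
    case False
    show ?thesis
    proof (cases "\<exists>i. j < i \<and> i < n \<and> \<not> c dvd G $$ (j,i)")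
      case True
      then obtain i where i: "j < i" "i < n" "\<not> c dvd G $$ (j,i)" by blast
      \<comment> \<open>Two entries that are nonzero modulo \<open>c\<close> would each have to be
        strictly smaller than the other, so entry \<open>i\<close> is the only one.\<close>
      have other: "c dvd G $$ (j,l)" if "j \<le> l" "l < n" "l \<noteq> i" for l
        using False that i by (metis less_imp_le nle_le)
      \<comment> \<open>The surviving entry moves to column \<open>j\<close>: after adding column
        \<open>i\<close> to column \<open>j\<close> and subtracting the new column \<open>j\<close>
        from column \<open>i\<close>, place \<open>i\<close> holds minus the old entry
        \<open>j\<close>, a multiple of \<open>c\<close>.\<close>
      define G1 where "G1 = ?add G i j 1"
      have G1: "col_equiv A n G G1" "unit_rows j n G1"
        "\<And>b. b < n \<Longrightarrow> G1 $$ (j,b) = (if b = j then G $$ (j,j) + G $$ (j,i) else G $$ (j,b))"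
        using add[OF G ur, of i j 1] i j one_mem unfolding G1_def by auto
      have G1c: "G1 \<in> carrier_mat k n" using col_equiv_carrier[OF G G1(1)] .
      define G2 where "G2 = ?add G1 j i (- 1)"
      have G2: "col_equiv A n G1 G2" "unit_rows j n G2"
        "\<And>b. b < n \<Longrightarrow> G2 $$ (j,b) = (if b = i then G1 $$ (j,i) - G1 $$ (j,j) else G1 $$ (j,b))"
        using add[OF G1c G1(2), of j i "-1"] i j uminus_mem[OF one_mem] unfolding G2_def by auto
      have "c dvd G2 $$ (j,b)" if "j < b" "b < n" for b
        using that i j other[of b] other[of j] by (auto simp: G2(3) G1(3))
      then show ?thesis using col_equiv_trans[OF G G1(1) G2(1)] G2(2) by blast
    next
      case False
      then show ?thesis using col_equiv_refl[OF G] ur by blast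
    qed
  qed
qed

text \<open>Euclid's algorithm leaves a pivot in row \<open>j\<close> with multiples of
  \<open>c\<close> to its right. Independence makes the pivot a unit of the ambient ring,
  primitivity yields an inverse modulo \<open>c\<close> inside \<open>A\<close>, and nilpotency of
  \<open>c\<close> corrects it to an exact one.\<close>

lemma clear_row:
  assumes G: "G \<in> carrier_mat k n" and GA: "mat_over A G" and j: "j < k" and ur: "unit_rows j n G"
    and ind: "independent_rows G" and prim: "primitive_rows A G"
  shows "\<exists>G'. col_equiv A n G G' \<and> j < n \<and> unit_rows (Suc j) n G'"
proof -
  \<comment> \<open>These coefficients subtract from row \<open>j\<close> the unit rows above it,
    which clears its entries in the columns before \<open>j\<close>.\<close>
  define u :: "'s mat \<Rightarrow> 's vec" where
    "u M = vec k (\<lambda>i. if i < j then - M $$ (j,i) else if i = j then 1 else 0)" for M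
  have comb: "(transpose_mat M *\<^sub>v u M) $ l = (if l < j then 0 else M $$ (j,l))"
    if M: "M \<in> carrier_mat k n" "unit_rows j n M" "l < n" for M l
  proof -
    have "(transpose_mat M *\<^sub>v u M) $ l = (\<Sum>i<k. M $$ (i,l) * u M $ i)"
      using M by (auto simp: scalar_prod_def u_def atLeast0LessThan intro!: sum.cong)
    also have "\<dots> = (\<Sum>i<k. (if i = l then if l < j then - M $$ (j,l) else 0 else 0) +
        (if i = j then M $$ (j,l) else 0))"
      using M by (intro sum.cong) (auto simp: u_def unit_rows_def)
    also have "\<dots> = (if l < j then 0 else M $$ (j,l))"
      using j by (cases "l < j") (auto simp: sum.distrib)
    finally show ?thesis .
  qed
  have uc: "u M \<in> carrier_vec k" for M by (simp add: u_def)
  \<comment> \<open>For \<open>j \<ge> n\<close> the combination is zero although its coefficient at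
    \<open>j\<close> is 1.\<close>
  have jn: "j < n"
  proof (rule ccontr)
    assume "\<not> j < n"
    then have "transpose_mat G *\<^sub>v u G = 0\<^sub>v n"
      using comb[OF G ur] G by (intro eq_vecI) auto
    then have "u G = 0\<^sub>v k" using ind G uc by (auto simp: independent_rows_def)
    then have "u G $ j = 0" using j by simp
    then show False using j by (simp add: u_def)
  qed
  obtain M where M: "col_equiv A n G M" "unit_rows j n M"
    and tail: "\<And>i. j < i \<Longrightarrow> i < n \<Longrightarrow> c dvd M $$ (j,i)"
    using euclid_row[OF G GA j jn ur] by blast
  have Mc: "M \<in> carrier_mat k n" using col_equiv_carrier[OF G M(1)] .
  have MA: "mat_over A M" using col_equiv_mat_over[OF G M(1) GA] .
  have Mind: "independent_rows M" using col_equiv_independent_rows[OF G M(1) ind] .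
  have Mprim: "primitive_rows A M" using col_equiv_primitive_rows[OF G M(1) prim] .
  define d where "d = M $$ (j,j)"
  have dA: "d \<in> A" using MA Mc j jn by (auto simp: d_def mat_over_def)
  have comb_smult: "(transpose_mat M *\<^sub>v (x \<cdot>\<^sub>v u M)) $ l = x * (if l < j then 0 else M $$ (j,l))"
    if "l < n" for x l
    using comb[OF Mc M(2) that] that Mc uc[of M] by (simp add: scalar_prod_smult_distrib[of _ k])
  have cm0: "c ^ m * M $$ (j,l) = 0" if "j < l" "l < n" for l
    using ann tail[OF that] by blast
  \<comment> \<open>Otherwise \<open>c ^ m\<close> kills the whole reduced row, a relation whose
    coefficient \<open>c ^ m\<close> at \<open>j\<close> is nonzero because \<open>c\<close> does
    not divide 1.\<close>
  have "\<not> c dvd d"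
  proof
    assume "c dvd d"
    then have "c ^ m * d = 0" using ann by blast
    then have "transpose_mat M *\<^sub>v (c ^ m \<cdot>\<^sub>v u M) = 0\<^sub>v n"
      using comb_smult[of _ "c ^ m"] Mc cm0
      by (intro eq_vecI) (auto simp: d_def not_less dest: le_neq_implies_less)
    then have "c ^ m \<cdot>\<^sub>v u M = 0\<^sub>v k"
      using Mind Mc uc[of M] by (auto simp: independent_rows_def)
    then have "(c ^ m \<cdot>\<^sub>v u M) $ j = 0" using j by simp
    then have "c ^ m * 1 = 0" using j by (simp add: u_def)
    then show False using ann not_c_dvd_1 by blast
  qed
  then obtain e where e: "d * e = 1" using unit by (metis dvdE)
  \<comment> \<open>The factor \<open>c ^ m\<close> kills the entries to the right and
    \<open>e\<close> turns the pivot into \<open>c ^ m\<close>, so the combination lies in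
    \<open>A\<close> even if \<open>e\<close> does not.\<close>
  have "(transpose_mat M *\<^sub>v ((c ^ m * e) \<cdot>\<^sub>v u M)) $ l \<in> A" if "l < n" for l
  proof -
    have "c ^ m * e * M $$ (j,l) = 0" if "j < l"
      using cm0[OF that \<open>l < n\<close>] by (metis mult.assoc mult.commute mult_zero_left)
    moreover have "c ^ m * e * M $$ (j,j) = c ^ m"
      using e by (simp add: d_def mult.assoc mult.commute[of e])
    ultimately show ?thesis
      unfolding comb_smult[OF that] using power_mem[OF c_mem, of m] zero_mem
      by (cases l j rule: linorder_cases) auto
  qed
  moreover have "(c ^ m * e) \<cdot>\<^sub>v u M \<in> carrier_vec k" using uc by simp
  ultimately have "((c ^ m * e) \<cdot>\<^sub>v u M) $ j \<in> A"
    using Mprim Mc j unfolding primitive_rows_def by (metis carrier_matD)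
  then have "c ^ m * e \<in> A" using j by (simp add: u_def)
  \<comment> \<open>By \<open>lift\<close>, the ambient inverse \<open>e\<close> agrees modulo
    \<open>c\<close> with an element of \<open>A\<close>.\<close>
  then obtain y where y: "y \<in> A" "c dvd e - y" using lift by blast
  have "1 - d * y = d * (e - y)" using e by (simp add: algebra_simps)
  then have "c dvd 1 - d * y" using y by simp
  then obtain z where z: "z \<in> A" "1 - d * y = c * z"
    using pure[of "1 - d * y"] one_mem dA y(1) diff_mem mult_mem by blast
  \<comment> \<open>Since \<open>c\<close> is nilpotent, a finite geometric series inverts
    \<open>d * y = 1 - c * z\<close>.\<close>
  define e' where "e' = y * (\<Sum>i<Suc m. (c * z) ^ i)"
  have e'A: "e' \<in> A"
    unfolding e'_def by (intro mult_mem y sum_mem power_mem z c_mem)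
  have "d * e' = (1 - c * z) * (\<Sum>i<Suc m. (c * z) ^ i)"
    using z(2) by (metis e'_def mult.assoc add_diff_cancel_left' diff_add_cancel)
  also have "\<dots> = 1 - (c * z) ^ Suc m" by (rule one_diff_power_eq[symmetric])
  also have "\<dots> = 1" unfolding power_mult_distrib c_nilpotent by simp
  finally have e': "d * e' = 1" .
  \<comment> \<open>Normalises the pivot to 1 and clears row \<open>j\<close> on both sides of it.
    The rows above are zero in column \<open>j\<close> and stay as they are.\<close>
  define r where "r b = (if b = j then e' else - (e' * M $$ (j,b)))" for b
  have "col_equiv A n M (M * row_rep n j r)"
  proof (rule col_equiv_row_rep[OF Mc jn, where d = d])
    show "r b \<in> A" if "b < n" for b
      using that MA Mc j e'A by (auto simp: r_def mat_over_def intro!: uminus_mem mult_mem)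
  qed (use dA e' in \<open>auto simp: r_def mult.commute\<close>)
  moreover have "unit_rows (Suc j) n (M * row_rep n j r)"
    unfolding unit_rows_def
  proof (intro allI impI)
    fix i l assume i: "i < Suc j" and l: "l < n"
    show "(M * row_rep n j r) $$ (i,l) = (if i = l then 1 else 0)"
    proof (cases "i = j")
      case True
      then show ?thesis
        using i j l e' mult_row_rep[OF Mc jn j l, of r]
        by (auto simp: r_def d_def mult.assoc[symmetric])
    next
      case False
      then have "i < j" "i < k" using i j by auto
      then show ?thesis
        using M(2) l jn mult_row_rep[OF Mc jn \<open>i < k\<close> l, of r]
        by (auto simp: r_def unit_rows_def)
    qed
  qed
  ultimately show ?thesis using col_equiv_trans[OF G M(1)] jn by blast
qed

lemma col_equiv_unit_rows:
  assumes G: "G \<in> carrier_mat k n" and GA: "mat_over A G"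
    and ind: "independent_rows G" and prim: "primitive_rows A G"
  shows "k \<le> n \<and> (\<exists>G'. col_equiv A n G G' \<and> unit_rows k n G')"
proof -
  have "j \<le> k \<Longrightarrow> j \<le> n \<and> (\<exists>G'. col_equiv A n G G' \<and> unit_rows j n G')" for j
  proof (induction j)
    case 0
    then show ?case using col_equiv_refl[OF G] by (auto simp: unit_rows_def)
  next
    case (Suc j)
    then obtain G1 where G1: "col_equiv A n G G1" "unit_rows j n G1" by auto
    have "\<exists>G'. col_equiv A n G1 G' \<and> j < n \<and> unit_rows (Suc j) n G'"
      using Suc.prems clear_row[OF col_equiv_carrier[OF G G1(1)] col_equiv_mat_over[OF G G1(1) GA]
          _ G1(2) col_equiv_independent_rows[OF G G1(1) ind] col_equiv_primitive_rows[OF G G1(1) prim]]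
      by auto
    then show ?case using col_equiv_trans[OF G G1(1)] by (metis Suc_leI)
  qed
  then show ?thesis by blast
qed

end

context local_euclidean_subring
begin

text \<open>If the rows of \<open>G * V\<close> are unit vectors, then
  \<open>G = (G * V) * W\<close> is the top block of \<open>W\<close>.\<close>

lemma extend_to_unimodular:
  assumes G: "G \<in> carrier_mat k n" and GA: "mat_over A G"
    and ind: "independent_rows G" and prim: "primitive_rows A G"
  obtains V W where "k \<le> n" "unimodular_pair A n V W" "\<And>i l. i < k \<Longrightarrow> l < n \<Longrightarrow> W $$ (i,l) = G $$ (i,l)"
proof -
  obtain V W where kn: "k \<le> n" and VW: "unimodular_pair A n V W" and ur: "unit_rows k n (G * V)"
    using col_equiv_unit_rows[OF assms] by (auto simp: col_equiv_def)
  have c: "V \<in> carrier_mat n n" "W \<in> carrier_mat n n" "V * W = 1\<^sub>m n"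
    using VW by (auto simp: unimodular_pair_def)
  define P where "P = G * V"
  have P: "P \<in> carrier_mat k n" using G c by (simp add: P_def)
  have G_eq: "P * W = G" unfolding P_def using assoc_mult_mat[OF G c(1,2)] c(3) G by simp
  have "W $$ (i,l) = G $$ (i,l)" if i: "i < k" and l: "l < n" for i l
  proof -
    have "G $$ (i,l) = (\<Sum>a<n. P $$ (i,a) * W $$ (a,l))"
      unfolding G_eq[symmetric] using P c i l by (auto simp: scalar_prod_def atLeast0LessThan)
    also have "\<dots> = (\<Sum>a<n. if i = a then W $$ (a,l) else 0)"
      using ur i by (intro sum.cong) (auto simp: unit_rows_def P_def[symmetric])
    finally show ?thesis using i kn by simp
  qed
  then show ?thesis using that kn VW by blast
qed

end

section \<open>Duals of row spaces\<close>

definition row_space :: "'s::comm_ring_1 mat \<Rightarrow> 's vec set" where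
  "row_space M = (\<lambda>u. transpose_mat M *\<^sub>v u) ` carrier_vec (dim_row M)"

text \<open>By adjointness, \<open>v\<close> is orthogonal to all \<open>u M\<close> exactly when
  \<open>M v\<close> is orthogonal to all \<open>u\<close>; unit vectors then give
  \<open>M v = 0\<close>.\<close>

lemma dual_code_row_space:
  fixes M :: "'a::comm_ring_1 fls mat"
  assumes M: "M \<in> carrier_mat k n"
  shows "dual_code n (row_space M) = {v \<in> carrier_vec n. M *\<^sub>v v = 0\<^sub>v k}"
proof -
  have adj: "v \<bullet> (transpose_mat M *\<^sub>v u) = (M *\<^sub>v v) \<bullet> u"
    if "v \<in> carrier_vec n" "u \<in> carrier_vec k" for u v
  proof -
    have "v \<bullet> (transpose_mat M *\<^sub>v u) = (transpose_mat M *\<^sub>v u) \<bullet> v"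
      using that M by (intro comm_scalar_prod[of _ n]) auto
    also have "\<dots> = u \<bullet> (M *\<^sub>v v)" by (rule transpose_vec_mult_scalar[OF M that])
    also have "\<dots> = (M *\<^sub>v v) \<bullet> u" using that M by (intro comm_scalar_prod[of _ k]) auto
    finally show ?thesis .
  qed
  show ?thesis
  proof (intro Set.set_eqI iffI)
    fix v assume "v \<in> dual_code n (row_space M)"
    then have v: "v \<in> carrier_vec n" and z: "\<And>u. u \<in> carrier_vec k \<Longrightarrow> (M *\<^sub>v v) \<bullet> u = 0"
      using adj M by (auto simp: dual_code_def row_space_def)
    have "(M *\<^sub>v v) $ i = 0" if "i < k" for i
      using z[of "unit_vec k i"] that M by (simp add: scalar_prod_right_unit[of _ k])
    then show "v \<in> {v \<in> carrier_vec n. M *\<^sub>v v = 0\<^sub>v k}" using v M by auto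
  next
    fix v assume "v \<in> {v \<in> carrier_vec n. M *\<^sub>v v = 0\<^sub>v k}"
    then show "v \<in> dual_code n (row_space M)"
      using adj M by (auto simp: dual_code_def row_space_def)
  qed
qed

text \<open>A parity-check matrix for the first \<open>k\<close> rows of the inverse of
  \<open>V\<close>.\<close>

definition lower_cols :: "nat \<Rightarrow> nat \<Rightarrow> 's mat \<Rightarrow> 's mat" where
  "lower_cols k n V = mat (n - k) n (\<lambda>(i,l). V $$ (l, k + i))"

definition pad_vec :: "nat \<Rightarrow> nat \<Rightarrow> 's::zero vec \<Rightarrow> 's vec" where
  "pad_vec k n w = vec n (\<lambda>a. if a < k then 0 else w $ (a - k))"

lemma lower_cols_carrier [simp]: "lower_cols k n V \<in> carrier_mat (n - k) n"
  by (simp add: lower_cols_def)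

lemma pad_vec_carrier [simp]: "pad_vec k n w \<in> carrier_vec n"
  by (simp add: pad_vec_def)

lemma lower_cols_mult_vec:
  fixes V :: "'s::comm_ring_1 mat"
  assumes V: "V \<in> carrier_mat n n" and k: "k \<le> n" and w: "w \<in> carrier_vec (n - k)"
  shows "transpose_mat (lower_cols k n V) *\<^sub>v w = V *\<^sub>v pad_vec k n w"
proof (rule eq_vecI)
  fix l assume "l < dim_vec (V *\<^sub>v pad_vec k n w)"
  then have l: "l < n" using V by simp
  have "(V *\<^sub>v pad_vec k n w) $ l = (\<Sum>a\<in>{0..<n}. V $$ (l,a) * pad_vec k n w $ a)"
    using l V by (auto simp: scalar_prod_def pad_vec_def intro!: sum.cong)
  also have "\<dots> = (\<Sum>a\<in>{k..<n}. V $$ (l,a) * pad_vec k n w $ a)"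
    by (rule sum.mono_neutral_right) (auto simp: pad_vec_def)
  also have "\<dots> = (\<Sum>i\<in>{0..<n-k}. V $$ (l,k+i) * pad_vec k n w $ (k+i))"
    using sum.shift_bounds_nat_ivl[of "\<lambda>a. V $$ (l,a) * pad_vec k n w $ a" 0 k "n - k"] k
    by (simp add: add.commute)
  also have "\<dots> = (transpose_mat (lower_cols k n V) *\<^sub>v w) $ l"
    using l w by (auto simp: scalar_prod_def pad_vec_def lower_cols_def intro!: sum.cong)
  finally show "(transpose_mat (lower_cols k n V) *\<^sub>v w) $ l = (V *\<^sub>v pad_vec k n w) $ l" by simp
qed (use V in \<open>simp add: lower_cols_def\<close>)

lemma unimodular_pair_cancel:
  assumes "unimodular_pair A n V W" "x \<in> carrier_vec n"
  shows "V *\<^sub>v (W *\<^sub>v x) = x" "W *\<^sub>v (V *\<^sub>v x) = x"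
proof -
  have VW: "V \<in> carrier_mat n n" "W \<in> carrier_mat n n" "V * W = 1\<^sub>m n" "W * V = 1\<^sub>m n"
    using assms by (auto simp: unimodular_pair_def)
  show "V *\<^sub>v (W *\<^sub>v x) = x" using assoc_mult_mat_vec[OF VW(1,2) assms(2)] VW(3) assms(2) by simp
  show "W *\<^sub>v (V *\<^sub>v x) = x" using assoc_mult_mat_vec[OF VW(2,1) assms(2)] VW(4) assms(2) by simp
qed

text \<open>\<open>M v = 0\<close> says that the first \<open>k\<close> coordinates of
  \<open>W v\<close> vanish; by \<open>v = V (W v)\<close> this means that \<open>v\<close> is a
  combination of the last columns of \<open>V\<close>.\<close>

lemma dual_code_row_space_unimodular:
  fixes M :: "'a::comm_ring_1 fls mat"
  assumes M: "M \<in> carrier_mat k n" and k: "k \<le> n" and VW: "unimodular_pair A n V W"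
    and MW: "\<And>i l. i < k \<Longrightarrow> l < n \<Longrightarrow> W $$ (i,l) = M $$ (i,l)"
  shows "dual_code n (row_space M) = row_space (lower_cols k n V)"
proof -
  have c: "V \<in> carrier_mat n n" "W \<in> carrier_mat n n"
    using VW by (auto simp: unimodular_pair_def)
  have first: "(W *\<^sub>v v) $ i = (M *\<^sub>v v) $ i" if "v \<in> carrier_vec n" "i < k" for v i
    using that c M k MW by (auto simp: scalar_prod_def intro!: sum.cong)
  show ?thesis unfolding dual_code_row_space[OF M]
  proof (intro Set.set_eqI iffI)
    fix v assume "v \<in> {v \<in> carrier_vec n. M *\<^sub>v v = 0\<^sub>v k}"
    then have v: "v \<in> carrier_vec n" "M *\<^sub>v v = 0\<^sub>v k" by auto
    define w where "w = vec (n - k) (\<lambda>i. (W *\<^sub>v v) $ (k + i))"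
    have w: "w \<in> carrier_vec (n - k)" by (simp add: w_def)
    have "W *\<^sub>v v = pad_vec k n w"
      using first[OF v(1)] v(2) c by (intro eq_vecI) (auto simp: pad_vec_def w_def simp del: index_mult_mat_vec)
    then have "v = transpose_mat (lower_cols k n V) *\<^sub>v w"
      using unimodular_pair_cancel(1)[OF VW v(1)] lower_cols_mult_vec[OF c(1) k w] by simp
    then show "v \<in> row_space (lower_cols k n V)"
      using w by (auto simp: row_space_def lower_cols_def)
  next
    fix v assume "v \<in> row_space (lower_cols k n V)"
    then obtain w where w: "w \<in> carrier_vec (n - k)"
      and v: "v = transpose_mat (lower_cols k n V) *\<^sub>v w"
      by (auto simp: row_space_def lower_cols_def)
    have v': "v = V *\<^sub>v pad_vec k n w" using lower_cols_mult_vec[OF c(1) k w] v by simp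
    then have vc: "v \<in> carrier_vec n" using c by simp
    have "W *\<^sub>v v = pad_vec k n w" unfolding v' by (rule unimodular_pair_cancel(2)[OF VW]) simp
    then have "M *\<^sub>v v = 0\<^sub>v k"
      using first[OF vc] M k by (intro eq_vecI) (auto simp: pad_vec_def simp del: index_mult_mat_vec)
    then show "v \<in> {v \<in> carrier_vec n. M *\<^sub>v v = 0\<^sub>v k}" using vc by simp
  qed
qed

text \<open>If \<open>x\<close> is orthogonal to the last columns of \<open>V\<close>, then
  \<open>y = V^T x\<close> vanishes from coordinate \<open>k\<close> on. In \<open>x = W^T y\<close>
  only the first \<open>k\<close> rows of \<open>W\<close>, which are those of \<open>M\<close>,
  contribute.\<close>

lemma dual_dual_row_space_unimodular:
  fixes M :: "'a::comm_ring_1 fls mat"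
  assumes M: "M \<in> carrier_mat k n" and k: "k \<le> n" and VW: "unimodular_pair A n V W"
    and MW: "\<And>i l. i < k \<Longrightarrow> l < n \<Longrightarrow> W $$ (i,l) = M $$ (i,l)"
  shows "dual_code n (dual_code n (row_space M)) = row_space M"
proof
  have c: "V \<in> carrier_mat n n" "W \<in> carrier_mat n n" "V * W = 1\<^sub>m n"
    using VW by (auto simp: unimodular_pair_def)
  have cc: "row_space M \<subseteq> carrier_vec n" using M by (auto simp: row_space_def)
  have "v \<bullet> w = w \<bullet> v" if "w \<in> dual_code n (row_space M)" "v \<in> row_space M" for v w
    using that cc by (intro comm_scalar_prod[of _ n]) (auto simp: dual_code_def)
  then show "row_space M \<subseteq> dual_code n (dual_code n (row_space M))"
    using cc by (auto simp: dual_code_def)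
  show "dual_code n (dual_code n (row_space M)) \<subseteq> row_space M"
  proof (rule subsetI)
    fix x assume "x \<in> dual_code n (dual_code n (row_space M))"
    then have "x \<in> {v \<in> carrier_vec n. lower_cols k n V *\<^sub>v v = 0\<^sub>v (n - k)}"
      by (simp only: dual_code_row_space_unimodular[OF assms] dual_code_row_space[OF lower_cols_carrier])
    then have x: "x \<in> carrier_vec n" and z: "lower_cols k n V *\<^sub>v x = 0\<^sub>v (n - k)" by auto
    define y where "y = transpose_mat V *\<^sub>v x"
    have "y $ a = 0" if "k \<le> a" "a < n" for a
    proof -
      have "y $ a = (lower_cols k n V *\<^sub>v x) $ (a - k)"
        using that c x by (auto simp: y_def lower_cols_def scalar_prod_def intro!: sum.cong)
      then show ?thesis using z that by simp
    qed
    have "x = transpose_mat M *\<^sub>v vec k (\<lambda>i. y $ i)"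
    proof (rule eq_vecI)
      fix l assume "l < dim_vec (transpose_mat M *\<^sub>v vec k (\<lambda>i. y $ i))"
      then have l: "l < n" using M by simp
      have "transpose_mat W *\<^sub>v y = (transpose_mat W * transpose_mat V) *\<^sub>v x"
        unfolding y_def using c x by (intro assoc_mult_mat_vec[of _ n n _ n, symmetric]) auto
      also have "transpose_mat W * transpose_mat V = 1\<^sub>m n"
        using transpose_mult[OF c(1,2)] c(3) by simp
      finally have "x $ l = (transpose_mat W *\<^sub>v y) $ l" using x by simp
      also have "\<dots> = (\<Sum>a\<in>{0..<n}. W $$ (a,l) * y $ a)"
        using c l by (auto simp: scalar_prod_def y_def intro!: sum.cong)
      also have "\<dots> = (\<Sum>a\<in>{0..<k}. W $$ (a,l) * y $ a)"
        by (rule sum.mono_neutral_right) (use k \<open>\<And>a. k \<le> a \<Longrightarrow> a < n \<Longrightarrow> y $ a = 0\<close> in auto)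
      also have "\<dots> = (transpose_mat M *\<^sub>v vec k (\<lambda>i. y $ i)) $ l"
        using M MW l by (auto simp: scalar_prod_def intro!: sum.cong)
      finally show "x $ l = (transpose_mat M *\<^sub>v vec k (\<lambda>i. y $ i)) $ l" .
    qed (use x M in auto)
    then show "x \<in> row_space M" unfolding row_space_def using M by auto
  qed
qed

section \<open>Laurent series over a local ring with nilpotent maximal ideal\<close>

definition laurent_polys :: "'a::zero fls set" where
  "laurent_polys = {f. finite {i. fls_nth f i \<noteq> 0}}"

text \<open>Lets series be built coefficientwise: vanishing wherever a given series does bounds the
  support from below.\<close>

lemma fls_nth_exists:
  fixes f :: "'a::zero fls" and h :: "int \<Rightarrow> 'b::zero"
  assumes "\<And>i. fls_nth f i = 0 \<Longrightarrow> h i = 0"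
  obtains g where "\<And>i. fls_nth g i = h i"
proof -
  have "fls_nth (Abs_fls h) i = h i" for i
    by (rule nth_Abs_fls_lower_bound[of "fls_subdegree f"]) (use assms in auto)
  then show ?thesis using that by blast
qed

lemma subring_laurent_polys: "subring (laurent_polys :: 'a::comm_ring_1 fls set)"
proof
  show "1 \<in> (laurent_polys :: 'a fls set)"
    by (auto simp: laurent_polys_def)
  fix x y :: "'a fls" assume xy: "x \<in> laurent_polys" "y \<in> laurent_polys"
  let ?S = "\<lambda>x :: 'a fls. {i. fls_nth x i \<noteq> 0}"
  have "?S (x - y) \<subseteq> ?S x \<union> ?S y" by auto
  then show "x - y \<in> laurent_polys" using xy by (auto simp: laurent_polys_def intro: finite_subset)
  have "?S (x * y) \<subseteq> (\<lambda>(i,j). i + j) ` (?S x \<times> ?S y)"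
  proof
    fix n assume "n \<in> ?S (x * y)"
    then have "(\<Sum>i=fls_subdegree x..n - fls_subdegree y. fls_nth x i * fls_nth y (n - i)) \<noteq> 0"
      by (simp add: fls_times_nth(2))
    then obtain i where "fls_nth x i * fls_nth y (n - i) \<noteq> 0" by (meson sum.not_neutral_contains_not_neutral)
    then show "n \<in> (\<lambda>(i,j). i + j) ` (?S x \<times> ?S y)"
      by (intro image_eqI[of _ _ "(i, n - i)"]) auto
  qed
  moreover have "finite ((\<lambda>(i,j). i + j) ` (?S x \<times> ?S y))" using xy by (auto simp: laurent_polys_def)
  ultimately show "x * y \<in> laurent_polys" unfolding laurent_polys_def using finite_subset by blast
qed

lemma one_minus_nilpotent_dvd_1:
  fixes a :: "'s::comm_ring_1"
  assumes "a ^ n = 0"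
  shows "1 - a dvd 1"
  using one_diff_power_eq[of a n] assms by (metis diff_zero dvd_triv_left)

text \<open>The model is the ring of integers modulo \<open>p ^ r\<close> with
  \<open>\<pi> = p\<close> and \<open>m = r - 1\<close>. Taking \<open>x = \<pi>\<close> in
  \<open>pi_ann\<close> gives \<open>\<pi> ^ Suc m = 0\<close>.\<close>

locale nilpotent_local_ring =
  fixes \<pi> :: "'a::comm_ring_1" and m :: nat
  assumes pi_ann: "\<pi> ^ m * x = 0 \<longleftrightarrow> \<pi> dvd x"
    and pi_unit: "\<not> \<pi> dvd x \<Longrightarrow> x dvd 1"
begin

definition pi_fls :: "'a fls" where "pi_fls = fls_const \<pi>"

lemma pi_fls_pow_nth: "fls_nth (pi_fls ^ j * f) i = \<pi> ^ j * fls_nth f i"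
  by (simp add: pi_fls_def fls_const_power[symmetric])

lemma pi_fls_dvd_iff: "pi_fls dvd f \<longleftrightarrow> (\<forall>i. \<pi> dvd fls_nth f i)"
proof
  assume "pi_fls dvd f"
  then show "\<forall>i. \<pi> dvd fls_nth f i" by (auto simp: pi_fls_def)
next
  assume *: "\<forall>i. \<pi> dvd fls_nth f i"
  then obtain q where q: "\<And>i. fls_nth f i = \<pi> * q i" unfolding dvd_def by metis
  \<comment> \<open>Quotients by the zero divisor \<open>\<pi>\<close> are not unique; choosing 0
    where \<open>f\<close> vanishes keeps the support bounded below.\<close>
  obtain g where g: "\<And>i. fls_nth g i = (if fls_nth f i = 0 then 0 else q i)"
    using fls_nth_exists[of f "\<lambda>i. if fls_nth f i = 0 then 0 else q i"] by auto
  have "f = pi_fls * g" by (rule fls_eqI) (auto simp: pi_fls_def g q)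
  then show "pi_fls dvd f" by simp
qed

lemma pi_fls_ann: "pi_fls ^ m * f = 0 \<longleftrightarrow> pi_fls dvd f"
  by (simp add: fls_eq_iff pi_fls_pow_nth pi_fls_dvd_iff pi_ann)

text \<open>Deleting the coefficients divisible by \<open>\<pi>\<close> leaves a series
  \<open>h\<close> whose leading coefficient is a unit, so \<open>h\<close> is invertible. As
  \<open>f\<close> differs from \<open>h\<close> by a multiple of \<open>pi_fls\<close>, its product
  with that inverse is 1 minus a nilpotent.\<close>

lemma pi_fls_unit:
  assumes "\<not> pi_fls dvd f"
  shows "f dvd 1"
proof -
  obtain h where h: "\<And>i. fls_nth h i = (if \<pi> dvd fls_nth f i then 0 else fls_nth f i)"
    using fls_nth_exists[of f "\<lambda>i. if \<pi> dvd fls_nth f i then 0 else fls_nth f i"] by auto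
  have "h \<noteq> 0" using assms h by (auto simp: pi_fls_dvd_iff fls_eq_iff)
  then have "fls_nth h (fls_subdegree h) \<noteq> 0" by simp
  then have "\<not> \<pi> dvd fls_nth h (fls_subdegree h)" using h by metis
  then obtain y where "fls_nth h (fls_subdegree h) * y = 1" using pi_unit by (metis dvdE)
  then have hu: "h * fls_right_inverse h y = 1" by (rule fls_right_inverse)
  have "pi_fls dvd h - f" by (auto simp: pi_fls_dvd_iff h)
  then obtain g where g: "h - f = pi_fls * g" by auto
  have "f * fls_right_inverse h y = 1 - pi_fls * (g * fls_right_inverse h y)"
    using hu g by (metis (no_types, lifting) diff_diff_eq2 add_diff_cancel_left' left_diff_distrib mult.assoc)
  moreover have "(pi_fls * (g * fls_right_inverse h y)) ^ Suc m = 0"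
    using pi_fls_ann[of pi_fls] unfolding power_mult_distrib by (simp add: mult.commute)
  ultimately show ?thesis using one_minus_nilpotent_dvd_1 by (metis dvd_mult_left)
qed

text \<open>Among all Laurent series every non-multiple of \<open>pi_fls\<close> is a unit, so
  division leaves remainder 0 and a two-valued size suffices.\<close>

lemma local_euclidean_UNIV:
  "local_euclidean_subring UNIV pi_fls m (\<lambda>f. if pi_fls dvd f then 0 else 1)"
proof (unfold_locales, goal_cases)
  case (9 x y)
  then obtain z where "y * z = 1" using pi_fls_unit by (metis dvdE)
  then have "x - (x * z) * y = 0" by (simp add: mult.assoc mult.commute[of z])
  then show ?case using 9 by (intro bexI[of _ "x * z"]) auto
next
  case (8 x)
  show ?case by (rule bexI[of _ x]) auto
qed (auto simp: pi_fls_ann pi_fls_unit)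

section \<open>Division of Laurent polynomials modulo \<open>\<pi>\<close>\<close>

definition supp_within :: "'a fls \<Rightarrow> int \<Rightarrow> nat \<Rightarrow> bool" where
  "supp_within f i N \<longleftrightarrow> (\<forall>j. \<not> \<pi> dvd fls_nth f j \<longrightarrow> i \<le> j \<and> j < i + int N)"

text \<open>Replaces the degree: powers of the variable are units, so on Laurent polynomials the
  size has to be invariant under shifts. Multiples of \<open>pi_fls\<close> get width 0.\<close>

definition width :: "'a fls \<Rightarrow> nat" where
  "width f = (LEAST N. \<exists>i. supp_within f i N)"

lemma supp_within_exists:
  assumes "f \<in> laurent_polys"
  shows "\<exists>N i. supp_within f i N"
proof -
  have fin: "finite {i. \<not> \<pi> dvd fls_nth f i}"
    using assms by (auto simp: laurent_polys_def elim: rev_finite_subset)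
  then obtain B where B: "\<And>i. \<not> \<pi> dvd fls_nth f i \<Longrightarrow> \<bar>i\<bar> \<le> B"
    using finite_imageI[OF fin, of abs] by (metis (mono_tags, lifting) Max_ge image_eqI mem_Collect_eq)
  then have "supp_within f (- B) (nat (2 * B + 1))" by (fastforce simp: supp_within_def)
  then show ?thesis by blast
qed

lemma width_le: "supp_within f i N \<Longrightarrow> width f \<le> N"
  unfolding width_def by (intro Least_le) blast

lemma supp_within_width: "f \<in> laurent_polys \<Longrightarrow> \<exists>i. supp_within f i (width f)"
  unfolding width_def using supp_within_exists[of f] by (rule LeastI_ex)

lemma laurent_poly_monom: "fls_const (u :: 'a) * fls_X_intpow s \<in> laurent_polys"
proof -
  have "{i. fls_nth (fls_const u * fls_X_intpow s) i \<noteq> 0} \<subseteq> {s}"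
    by (subst fls_X_intpow_times_conv_shift(2)) auto
  then show ?thesis unfolding laurent_polys_def using finite_subset by blast
qed

text \<open>Long division from the top: the top coefficient of \<open>y\<close> modulo
  \<open>\<pi>\<close> is a unit, and each step shortens the window of \<open>x\<close> by one at
  its upper end.\<close>

lemma laurent_division:
  assumes "x \<in> laurent_polys" "y \<in> laurent_polys" "\<not> pi_fls dvd y"
  shows "\<exists>q\<in>laurent_polys. width (x - q * y) < width y"
proof -
  interpret L: subring "laurent_polys :: 'a fls set" by (rule subring_laurent_polys)
  obtain b where b: "supp_within y b (width y)" using supp_within_width assms by blast
  have pos: "width y > 0"
  proof (rule ccontr)
    assume "\<not> width y > 0"
    then show False using b assms(3) by (force simp: supp_within_def pi_fls_dvd_iff)
  qed
  \<comment> \<open>The last exponent of the shortest window; by minimality the coefficient there is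
    not divisible by \<open>\<pi>\<close>.\<close>
  define t where "t = b + int (width y) - 1"
  have "\<not> \<pi> dvd fls_nth y t"
  proof
    assume *: "\<pi> dvd fls_nth y t"
    have "supp_within y b (width y - 1)" unfolding supp_within_def
    proof (intro allI impI)
      fix j assume j: "\<not> \<pi> dvd fls_nth y j"
      then have "b \<le> j" "j < b + int (width y)" using b by (auto simp: supp_within_def)
      moreover have "j \<noteq> t" using j * by auto
      ultimately show "b \<le> j \<and> j < b + int (width y - 1)" by (auto simp: t_def)
    qed
    then show False using width_le pos by fastforce
  qed
  then obtain v where v: "fls_nth y t * v = 1" using pi_unit by (metis dvdE)
  have "x \<in> laurent_polys \<Longrightarrow> supp_within x a N \<Longrightarrow> \<exists>q\<in>laurent_polys. width (x - q * y) < width y" for x a N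
  proof (induction N arbitrary: x)
    case 0
    then show ?case using pos width_le[of x a 0] L.zero_mem by (intro bexI[of _ 0]) auto
  next
    case (Suc N)
    show ?case
    proof (cases "Suc N < width y")
      case True
      then show ?thesis using width_le[OF Suc.prems(2)] L.zero_mem by (intro bexI[of _ 0]) auto
    next
      case False
      \<comment> \<open>Aligns exponent \<open>t\<close> of \<open>y\<close> with the top exponent
        \<open>a + int N\<close> of the window of \<open>x\<close>. Since
        \<open>width y \<le> Suc N\<close>, the shifted window of \<open>y\<close> does not reach
        below \<open>a\<close>.\<close>
      define s where "s = a + int N - t"
      define q where "q = fls_const (fls_nth x (a + int N) * v) * fls_X_intpow s"
      have qL: "q \<in> laurent_polys" unfolding q_def by (rule laurent_poly_monom)
      have nth: "fls_nth (x - q * y) j = fls_nth x j - fls_nth x (a + int N) * v * fls_nth y (j - s)" for j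
        unfolding q_def mult.assoc[of _ _ y] fls_X_intpow_times_conv_shift(1) by simp
      have "supp_within (x - q * y) a N" unfolding supp_within_def
      proof (intro allI impI)
        fix j assume j: "\<not> \<pi> dvd fls_nth (x - q * y) j"
        have "\<not> \<pi> dvd fls_nth x j \<or> \<not> \<pi> dvd fls_nth y (j - s)"
          using j unfolding nth by (metis dvd_diff dvd_mult)
        then have "a \<le> j \<and> j \<le> a + int N"
          using Suc.prems(2) b False by (auto simp: supp_within_def s_def t_def)
        moreover have "j \<noteq> a + int N"
        proof
          assume "j = a + int N"
          then have "fls_nth (x - q * y) j = fls_nth x j - fls_nth x j * (fls_nth y t * v)"
            unfolding nth by (simp add: s_def mult.assoc mult.commute[of v])
          then show False using j v by simp
        qed
        ultimately show "a \<le> j \<and> j < a + int N" by auto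
      qed
      then obtain q' where q': "q' \<in> laurent_polys" "width (x - q * y - q' * y) < width y"
        using Suc.IH[of "x - q * y"] Suc.prems(1) qL assms(2) L.diff_mem L.mult_mem by blast
      have "x - (q + q') * y = x - q * y - q' * y" by (simp add: algebra_simps)
      then show ?thesis using q' qL L.add_mem by (metis (no_types))
    qed
  qed
  then show ?thesis using supp_within_exists[OF assms(1)] assms(1) by blast
qed

lemma local_euclidean_laurent_polys: "local_euclidean_subring laurent_polys pi_fls m width"
proof -
  interpret L: subring "laurent_polys :: 'a fls set" by (rule subring_laurent_polys)
  show ?thesis
  proof
    show "pi_fls \<in> laurent_polys" using laurent_poly_monom[of \<pi> 0] by (simp add: pi_fls_def)
    show "pi_fls ^ m * x = 0 \<longleftrightarrow> pi_fls dvd x" for x by (rule pi_fls_ann)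
    show "x dvd 1" if "\<not> pi_fls dvd x" for x using pi_fls_unit[OF that] .
    show "\<exists>q\<in>laurent_polys. width (x - q * y) < width y"
      if "x \<in> laurent_polys" "y \<in> laurent_polys" "\<not> pi_fls dvd y" for x y
      using laurent_division[OF that] .
    show "\<exists>y\<in>laurent_polys. x = pi_fls * y" if x: "x \<in> laurent_polys" "pi_fls dvd x" for x
    proof -
      obtain z where z: "x = pi_fls * z" using x by auto
      \<comment> \<open>A quotient may have infinite support where \<open>x\<close> vanishes; it is
        cut down to the support of \<open>x\<close>.\<close>
      obtain y where y: "\<And>i. fls_nth y i = (if fls_nth x i = 0 then 0 else fls_nth z i)"
        using fls_nth_exists[of x "\<lambda>i. if fls_nth x i = 0 then 0 else fls_nth z i"] by auto
      have "{i. fls_nth y i \<noteq> 0} \<subseteq> {i. fls_nth x i \<noteq> 0}" using y by auto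
      then have "y \<in> laurent_polys" using x by (auto simp: laurent_polys_def intro: finite_subset)
      moreover have "x = pi_fls * y"
        by (rule fls_eqI) (use z y pi_fls_pow_nth[of 1] in auto)
      ultimately show ?thesis by blast
    qed
    show "\<exists>y\<in>laurent_polys. pi_fls dvd x - y" if x: "pi_fls ^ m * x \<in> laurent_polys" for x
    proof -
      \<comment> \<open>The coefficients kept are exactly those not killed by
        \<open>\<pi> ^ m\<close>, hence finitely many.\<close>
      obtain y where y: "\<And>i. fls_nth y i = (if \<pi> dvd fls_nth x i then 0 else fls_nth x i)"
        using fls_nth_exists[of x "\<lambda>i. if \<pi> dvd fls_nth x i then 0 else fls_nth x i"] by auto
      have "{i. fls_nth y i \<noteq> 0} \<subseteq> {i. fls_nth (pi_fls ^ m * x) i \<noteq> 0}"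
        using y by (auto simp: pi_fls_pow_nth pi_ann)
      then have "y \<in> laurent_polys" using x by (auto simp: laurent_polys_def intro: finite_subset)
      moreover have "pi_fls dvd x - y" by (auto simp: pi_fls_dvd_iff y)
      ultimately show ?thesis by blast
    qed
  qed
qed

end

text \<open>Both properties are read off an integer representative \<open>a\<close>: Bezout inverts
  it when it is prime to \<open>p\<close>, and \<open>p ^ r\<close> divides
  \<open>p ^ (r - 1) * a\<close> exactly when \<open>p\<close> divides \<open>a\<close>.\<close>

lemma mod_ring_nilpotent_local:
  assumes "prime p" and "r \<ge> 1" and card: "CARD('a::nontriv) = p ^ r"
  shows "nilpotent_local_ring (of_nat p :: 'a mod_ring) (r - 1)"
proof
  have zero_iff: "(of_int a :: 'a mod_ring) = 0 \<longleftrightarrow> int p ^ r dvd a" for a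
  proof -
    have "(of_int a :: 'a mod_ring) = 0 \<longleftrightarrow> a mod int (CARD('a)) = 0"
      by transfer simp
    then show ?thesis by (simp add: card dvd_eq_mod_eq_0)
  qed
  fix x :: "'a mod_ring"
  obtain a where x: "x = of_int a"
    by (metis of_int_mod_ring_to_int_mod_ring of_int_of_int_mod_ring)
  have pr: "int p ^ r = int p ^ (r - 1) * int p" using assms(2) by (cases r) auto
  have p0: "int p \<noteq> 0" using assms(1) by (auto simp: prime_gt_0_nat)
  have dvd_imp: "(of_nat p :: 'a mod_ring) dvd x" if "int p dvd a"
    using that x by (auto simp: dvd_def)
  show "x dvd 1" if "\<not> of_nat p dvd x"
  proof -
    have "coprime (int p) a"
      by (rule prime_imp_coprime) (use dvd_imp that assms(1) in auto)
    then have "coprime (int p ^ r) a" by simp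
    then obtain s t where "s * int p ^ r + t * a = 1"
      using bezout_int[of "int p ^ r" a] by auto
    then have "(of_int (s * int p ^ r + t * a) :: 'a mod_ring) = 1" by simp
    moreover have "(of_int (s * int p ^ r) :: 'a mod_ring) = 0" unfolding zero_iff by simp
    ultimately have "of_int t * x = 1" unfolding of_int_add x by simp
    then show ?thesis by (metis dvd_triv_right)
  qed
  show "of_nat p ^ (r - 1) * x = 0 \<longleftrightarrow> of_nat p dvd x"
  proof
    assume "of_nat p ^ (r - 1) * x = 0"
    then have "(of_int (int p ^ (r - 1) * a) :: 'a mod_ring) = 0" by (simp add: x)
    then have "int p dvd a" unfolding zero_iff pr using p0 by simp
    then show "of_nat p dvd x" by (rule dvd_imp)
  next
    assume "of_nat p dvd x"
    then obtain y where y: "x = of_nat p * y" by auto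
    have "(of_int (int p ^ r) :: 'a mod_ring) = 0" unfolding zero_iff by simp
    then have "(of_nat p ^ (r - 1) * of_nat p :: 'a mod_ring) = 0" unfolding pr by simp
    then show "of_nat p ^ (r - 1) * x = 0" unfolding y by (metis mult.assoc mult_zero_left)
  qed
qed

section \<open>Catastrophic codes and their duals\<close>

lemma wt_fls_finite_iff: "wt_fls f < \<infinity> \<longleftrightarrow> f \<in> laurent_polys"
  by (simp add: wt_fls_def laurent_polys_def)

lemma wt_vec_finite_iff: "wt_vec v < \<infinity> \<longleftrightarrow> (\<forall>i<dim_vec v. v $ i \<in> laurent_polys)"
proof -
  have "(\<Sum>i<N. wt_fls (v $ i)) < \<infinity> \<longleftrightarrow> (\<forall>i<N. v $ i \<in> laurent_polys)" for N
    by (induction N) (auto simp: less_Suc_eq plus_eq_infty_iff_enat wt_fls_finite_iff[symmetric])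
  then show ?thesis by (simp add: wt_vec_def)
qed

lemma laurent_mat_carrier [simp]: "laurent_mat G \<in> carrier_mat k n \<longleftrightarrow> G \<in> carrier_mat k n"
  by (auto simp: laurent_mat_def)

lemma laurent_mat_over: "mat_over laurent_polys (laurent_mat G)"
proof -
  have "{i. fls_nth (fps_to_fls (fps_of_poly q)) i \<noteq> 0} \<subseteq> int ` {..degree q}" for q :: "'a poly"
  proof
    fix i assume "i \<in> {i. fls_nth (fps_to_fls (fps_of_poly q)) i \<noteq> 0}"
    then have "0 \<le> i" "poly.coeff q (nat i) \<noteq> 0" by (auto split: if_splits)
    then show "i \<in> int ` {..degree q}" by (intro image_eqI[of _ _ "nat i"]) (auto simp: le_degree)
  qed
  then have "fps_to_fls (fps_of_poly q) \<in> laurent_polys" for q :: "'a poly"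
    unfolding laurent_polys_def by (metis (mono_tags) finite_atMost finite_imageI finite_subset mem_Collect_eq)
  then show ?thesis by (auto simp: mat_over_def laurent_mat_def)
qed

lemma generator_matrix_iff:
  "generator_matrix n k G C \<longleftrightarrow>
     G \<in> carrier_mat k n \<and> independent_rows (laurent_mat G) \<and> C = row_space (laurent_mat G)"
  by (auto simp: generator_matrix_def full_rank_def independent_rows_def encode_def row_space_def
      laurent_mat_def)

text \<open>The other half of the equivalence is automatic: the entries of \<open>G\<close> are
  polynomials, so finite \<open>u\<close> gives finite \<open>u G\<close>.\<close>

lemma non_catastrophic_iff:
  fixes G :: "'a::comm_ring_1 poly mat"
  shows "non_catastrophic G \<longleftrightarrow> primitive_rows laurent_polys (laurent_mat G)"
proof -
  interpret L: subring "laurent_polys :: 'a fls set" by (rule subring_laurent_polys)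
  have dims: "dim_row (laurent_mat G) = dim_row G" "dim_col (laurent_mat G) = dim_col G"
    by (simp_all add: laurent_mat_def)
  have "mat_over laurent_polys (transpose_mat (laurent_mat G))"
    using laurent_mat_over[of G] by (auto simp: mat_over_def)
  then have bounded: "(transpose_mat (laurent_mat G) *\<^sub>v u) $ l \<in> laurent_polys"
    if "u \<in> carrier_vec (dim_row G)" "\<forall>i<dim_row G. u $ i \<in> laurent_polys" "l < dim_col G"
    for u :: "'a fls vec" and l
    using that by (intro L.mult_mat_vec_mem) (auto simp: dims)
  have wt: "wt_vec (encode G u) < \<infinity> \<longleftrightarrow>
      (\<forall>l<dim_col G. (transpose_mat (laurent_mat G) *\<^sub>v u) $ l \<in> laurent_polys)"
    for u :: "'a fls vec"
    unfolding wt_vec_finite_iff encode_def by (simp add: dims)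
  have "wt_vec u < \<infinity> \<longleftrightarrow> (\<forall>i<dim_row G. u $ i \<in> laurent_polys)"
    if "u \<in> carrier_vec (dim_row G)" for u :: "'a fls vec"
    using that unfolding wt_vec_finite_iff by simp
  with wt bounded show ?thesis unfolding non_catastrophic_def primitive_rows_def dims by blast
qed

section \<open>From Laurent polynomial matrices to polynomial ones\<close>

lemma laurent_poly_shift_poly:
  fixes f :: "'a::comm_ring_1 fls"
  assumes "f \<in> laurent_polys" and "- fls_subdegree f \<le> int N"
  shows "\<exists>q. fls_X_intpow (int N) * f = fps_to_fls (fps_of_poly q)"
proof -
  define h where "h j = fls_nth f (int j - int N)" for j
  have "finite {j. h j \<noteq> 0}"
  proof (rule finite_imageD)
    have "(\<lambda>j. int j - int N) ` {j. h j \<noteq> 0} \<subseteq> {i. fls_nth f i \<noteq> 0}" by (auto simp: h_def)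
    then show "finite ((\<lambda>j. int j - int N) ` {j. h j \<noteq> 0})"
      using assms(1) by (auto simp: laurent_polys_def intro: finite_subset)
  qed (auto simp: inj_on_def)
  then have "poly.coeff (Abs_poly h) = h"
    by (intro Abs_poly_inverse) (simp add: MOST_iff_cofinite)
  moreover have "fls_nth f (i - int N) = 0" if "i < 0" for i
    using assms(2) that by (intro fls_eq0_below_subdegree) auto
  ultimately have "fls_X_intpow (int N) * f = fps_to_fls (fps_of_poly (Abs_poly h))"
    by (intro fls_eqI) (auto simp: fls_X_intpow_times_conv_shift(1) h_def)
  then show ?thesis by blast
qed

lemma laurent_mat_shift_poly:
  assumes "M \<in> carrier_mat k n" and "mat_over laurent_polys M"
  shows "\<exists>N H. H \<in> carrier_mat k n \<and> laurent_mat H = fls_X_intpow (int N) \<cdot>\<^sub>m M"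
proof -
  define S where "S = (\<lambda>(i,j). nat (- fls_subdegree (M $$ (i,j)))) ` ({..<k} \<times> {..<n})"
  \<comment> \<open>The largest pole order among the entries; the inserted 0 covers a matrix without
    entries.\<close>
  define N where "N = Max (insert 0 S)"
  have "- fls_subdegree (M $$ (i,j)) \<le> int N" if "i < k" "j < n" for i j
  proof -
    have "nat (- fls_subdegree (M $$ (i,j))) \<in> S" using that by (force simp: S_def)
    then have "nat (- fls_subdegree (M $$ (i,j))) \<le> N"
      unfolding N_def by (intro Max_ge) (auto simp: S_def)
    then show ?thesis by simp
  qed
  then have "\<forall>i j. i < k \<and> j < n \<longrightarrow> (\<exists>q. fls_X_intpow (int N) * M $$ (i,j) = fps_to_fls (fps_of_poly q))"
    using assms by (auto simp: mat_over_def intro!: laurent_poly_shift_poly)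
  then obtain q where q: "\<And>i j. i < k \<Longrightarrow> j < n \<Longrightarrow>
      fls_X_intpow (int N) * M $$ (i,j) = fps_to_fls (fps_of_poly (q i j))" by metis
  have "laurent_mat (mat k n (\<lambda>(i,j). q i j)) = fls_X_intpow (int N) \<cdot>\<^sub>m M"
    by (rule eq_matI) (use assms q in \<open>auto simp: laurent_mat_def\<close>)
  then show ?thesis by (metis mat_carrier)
qed

text \<open>The product is \<open>V\<close> applied to the padded \<open>u\<close>, and applying
  \<open>W\<close>, with entries in \<open>A\<close>, returns the padded \<open>u\<close>.\<close>

lemma (in subring) primitive_rows_lower_cols:
  assumes k: "k \<le> n" and VW: "unimodular_pair A n V W"
  shows "primitive_rows A (lower_cols k n V)"
  unfolding primitive_rows_def
proof (intro ballI impI allI)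
  have c: "V \<in> carrier_mat n n" "W \<in> carrier_mat n n" "mat_over A W"
    using VW by (auto simp: unimodular_pair_def)
  fix u i assume u: "u \<in> carrier_vec (dim_row (lower_cols k n V))"
    and mem: "\<forall>l<dim_col (lower_cols k n V). (transpose_mat (lower_cols k n V) *\<^sub>v u) $ l \<in> A"
    and i: "i < dim_row (lower_cols k n V)"
  have uc: "u \<in> carrier_vec (n - k)" using u by (simp add: lower_cols_def)
  have "(V *\<^sub>v pad_vec k n u) $ l \<in> A" if "l < n" for l
    using mem that unfolding lower_cols_mult_vec[OF c(1) k uc] by (simp add: lower_cols_def)
  then have "(W *\<^sub>v (V *\<^sub>v pad_vec k n u)) $ (k + i) \<in> A"
    using c i by (intro mult_mat_vec_mem) (auto simp: lower_cols_def simp del: index_mult_mat_vec)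
  then show "u $ i \<in> A"
    unfolding unimodular_pair_cancel(2)[OF VW pad_vec_carrier]
    using i by (simp add: pad_vec_def lower_cols_def)
qed

lemma independent_rows_lower_cols:
  assumes k: "k \<le> n" and VW: "unimodular_pair A n V W"
  shows "independent_rows (lower_cols k n V)"
  unfolding independent_rows_def
proof (intro ballI impI)
  have c: "V \<in> carrier_mat n n" "W \<in> carrier_mat n n"
    using VW by (auto simp: unimodular_pair_def)
  fix u assume u: "u \<in> carrier_vec (dim_row (lower_cols k n V))"
    and z: "transpose_mat (lower_cols k n V) *\<^sub>v u = 0\<^sub>v (dim_col (lower_cols k n V))"
  have uc: "u \<in> carrier_vec (n - k)" using u by (simp add: lower_cols_def)
  have "V *\<^sub>v pad_vec k n u = 0\<^sub>v n"
    using z unfolding lower_cols_mult_vec[OF c(1) k uc] by (simp add: lower_cols_def)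
  then have "pad_vec k n u = W *\<^sub>v 0\<^sub>v n"
    using unimodular_pair_cancel(2)[OF VW pad_vec_carrier] by metis
  also have "\<dots> = 0\<^sub>v n" using c by auto
  finally have z: "pad_vec k n u = 0\<^sub>v n" .
  have "u $ i = 0" if "i < n - k" for i
  proof -
    have "pad_vec k n u $ (k + i) = 0\<^sub>v n $ (k + i)" by (simp only: z)
    then show ?thesis using that by (simp add: pad_vec_def)
  qed
  then show "u = 0\<^sub>v (dim_row (lower_cols k n V))" using uc by (intro eq_vecI) (auto simp: lower_cols_def)
qed

lemma transpose_smult_mult_vec:
  fixes M :: "'s::comm_ring_1 mat"
  assumes "M \<in> carrier_mat k n" "u \<in> carrier_vec k"
  shows "transpose_mat (a \<cdot>\<^sub>m M) *\<^sub>v u = transpose_mat M *\<^sub>v (a \<cdot>\<^sub>v u)"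
  by (rule eq_vecI) (use assms in \<open>auto simp: scalar_prod_def mult.assoc mult.commute[of a] intro!: sum.cong\<close>)

text \<open>Used with \<open>a\<close> a power of the variable, to make an encoder polynomial.
  Primitivity puts \<open>a u\<close> in \<open>A\<close>, and \<open>b\<close> in \<open>A\<close>
  brings it back to \<open>u\<close>.\<close>

lemma row_scaling:
  fixes M :: "'s::comm_ring_1 mat"
  assumes M: "M \<in> carrier_mat k n" and a: "a * b = 1"
  shows "independent_rows M \<Longrightarrow> independent_rows (a \<cdot>\<^sub>m M)"
    and "row_space (a \<cdot>\<^sub>m M) = row_space M"
    and "subring A \<Longrightarrow> b \<in> A \<Longrightarrow> primitive_rows A M \<Longrightarrow> primitive_rows A (a \<cdot>\<^sub>m M)"
proof -
  have ba: "b \<cdot>\<^sub>v (a \<cdot>\<^sub>v u) = u" "a \<cdot>\<^sub>v (b \<cdot>\<^sub>v u) = u" for u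
    using a mult.commute[of b a] by (auto intro!: eq_vecI simp: mult.assoc[symmetric])
  note T = transpose_smult_mult_vec[OF M]
  have d: "dim_row (a \<cdot>\<^sub>m M) = k" "dim_col (a \<cdot>\<^sub>m M) = n" "dim_row M = k" "dim_col M = n"
    using M by auto
  show "row_space (a \<cdot>\<^sub>m M) = row_space M"
  proof (intro equalityI subsetI)
    fix v assume "v \<in> row_space (a \<cdot>\<^sub>m M)"
    then obtain u where u: "u \<in> carrier_vec k" "v = transpose_mat (a \<cdot>\<^sub>m M) *\<^sub>v u"
      unfolding row_space_def d by auto
    then have "v = transpose_mat M *\<^sub>v (a \<cdot>\<^sub>v u)" by (simp only: T)
    then show "v \<in> row_space M" unfolding row_space_def d
      by (rule image_eqI[OF _ iffD2[OF smult_carrier_vec u(1)]])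
  next
    fix v assume "v \<in> row_space M"
    then obtain u where u: "u \<in> carrier_vec k" "v = transpose_mat M *\<^sub>v u"
      unfolding row_space_def d by auto
    then have "v = transpose_mat (a \<cdot>\<^sub>m M) *\<^sub>v (b \<cdot>\<^sub>v u)"
      by (simp only: T[OF iffD2[OF smult_carrier_vec u(1)]] ba)
    then show "v \<in> row_space (a \<cdot>\<^sub>m M)" unfolding row_space_def d
      by (rule image_eqI[OF _ iffD2[OF smult_carrier_vec u(1)]])
  qed
  show "independent_rows (a \<cdot>\<^sub>m M)" if ind: "independent_rows M"
    unfolding independent_rows_def d
  proof (intro ballI impI)
    fix u :: "'s vec" assume u: "u \<in> carrier_vec k" and z: "transpose_mat (a \<cdot>\<^sub>m M) *\<^sub>v u = 0\<^sub>v n"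
    have "a \<cdot>\<^sub>v u \<in> carrier_vec k" using u by simp
    then have "a \<cdot>\<^sub>v u = 0\<^sub>v k"
      using ind z unfolding independent_rows_def d T[OF u] by blast
    then have "u = b \<cdot>\<^sub>v 0\<^sub>v k" using ba(1)[of u] by simp
    also have "\<dots> = 0\<^sub>v k" by (rule eq_vecI) auto
    finally show "u = 0\<^sub>v k" .
  qed
  show "primitive_rows A (a \<cdot>\<^sub>m M)" if A: "subring A" and b: "b \<in> A" and prim: "primitive_rows A M"
    unfolding primitive_rows_def d
  proof (intro ballI impI allI)
    fix u :: "'s vec" and i assume u: "u \<in> carrier_vec k" and i: "i < k"
      and mem: "\<forall>l<n. (transpose_mat (a \<cdot>\<^sub>m M) *\<^sub>v u) $ l \<in> A"
    have "a \<cdot>\<^sub>v u \<in> carrier_vec k" using u by simp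
    then have "(a \<cdot>\<^sub>v u) $ i \<in> A"
      using prim mem i unfolding primitive_rows_def d T[OF u] by blast
    then have "b * (a * u $ i) \<in> A" using subring.mult_mem[OF A b] u i by simp
    moreover have "b * (a * u $ i) = u $ i" using a by (metis mult.assoc mult.commute mult_1_left)
    ultimately show "u $ i \<in> A" by simp
  qed
qed

section \<open>Double duals and duals of non-catastrophic codes\<close>

context nilpotent_local_ring
begin

text \<open>With \<open>A\<close> the ring of all Laurent series primitivity is trivial, so every
  encoder, catastrophic or not, extends to an invertible matrix.\<close>

lemma dual_dual_code:
  fixes C :: "'a fls vec set"
  assumes "free_conv_code n k C"
  shows "dual_code n (dual_code n C) = C"
proof -
  interpret E: local_euclidean_subring "UNIV :: 'a fls set" pi_fls m "\<lambda>f. if pi_fls dvd f then 0 else 1"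
    by (rule local_euclidean_UNIV)
  obtain G where G: "laurent_mat G \<in> carrier_mat k n" "independent_rows (laurent_mat G)"
    "C = row_space (laurent_mat G)"
    using assms by (auto simp: free_conv_code_def generator_matrix_iff)
  have "mat_over UNIV (laurent_mat G)" "primitive_rows UNIV (laurent_mat G)"
    by (auto simp: mat_over_def primitive_rows_def)
  then obtain V W where VW: "k \<le> n" "unimodular_pair UNIV n V W"
    "\<And>i l. i < k \<Longrightarrow> l < n \<Longrightarrow> W $$ (i,l) = laurent_mat G $$ (i,l)"
    using E.extend_to_unimodular[OF G(1) _ G(2)] by blast
  show ?thesis unfolding G(3) by (rule dual_dual_row_space_unimodular[OF G(1) VW])
qed

text \<open>A non-catastrophic encoder extends to a matrix invertible over the Laurent polynomials.
  The last columns of the inverse, shifted to be polynomial, encode the dual and inherit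
  primitivity.\<close>

lemma not_catastrophic_dual_code:
  fixes C :: "'a fls vec set"
  assumes "\<not> catastrophic_code n C"
  shows "\<not> catastrophic_code n (dual_code n C)"
proof -
  interpret E: local_euclidean_subring "laurent_polys :: 'a fls set" pi_fls m width
    by (rule local_euclidean_laurent_polys)
  obtain k G where G: "laurent_mat G \<in> carrier_mat k n" "independent_rows (laurent_mat G)"
    "C = row_space (laurent_mat G)" and prim: "primitive_rows laurent_polys (laurent_mat G)"
    using assms by (auto simp: catastrophic_code_def generator_matrix_iff non_catastrophic_iff)
  obtain V W where VW: "k \<le> n" "unimodular_pair laurent_polys n V W"
    "\<And>i l. i < k \<Longrightarrow> l < n \<Longrightarrow> W $$ (i,l) = laurent_mat G $$ (i,l)"
    using E.extend_to_unimodular[OF G(1) laurent_mat_over G(2) prim] by blast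
  define P where "P = lower_cols k n V"
  have P: "P \<in> carrier_mat (n - k) n" by (simp add: P_def)
  have dual: "dual_code n C = row_space P"
    unfolding G(3) P_def by (rule dual_code_row_space_unimodular[OF G(1) VW])
  have "mat_over laurent_polys P"
    using VW(1,2) by (auto simp: P_def lower_cols_def unimodular_pair_def mat_over_def)
  then obtain N H where H: "H \<in> carrier_mat (n - k) n" "laurent_mat H = fls_X_intpow (int N) \<cdot>\<^sub>m P"
    using laurent_mat_shift_poly[OF P] by blast
  have X: "(fls_X_intpow (int N) :: 'a fls) * fls_X_intpow (- int N) = 1"
    by (subst fls_X_intpow_times_fls_X_intpow) simp
  have XL: "(fls_X_intpow (- int N) :: 'a fls) \<in> laurent_polys"
    using laurent_poly_monom[of 1 "- int N"] by simp
  have "generator_matrix n (n - k) H (dual_code n C)"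
    unfolding generator_matrix_iff dual H(2) row_scaling(2)[OF P X]
    using H(1) row_scaling(1)[OF P X] independent_rows_lower_cols[OF VW(1,2)] by (simp add: P_def)
  moreover have "non_catastrophic H"
    unfolding non_catastrophic_iff H(2)
    using row_scaling(3)[OF P X E.subring_axioms XL] E.primitive_rows_lower_cols[OF VW(1,2)]
    by (simp add: P_def)
  ultimately show ?thesis by (auto simp: catastrophic_code_def)
qed

end

theorem corollary4p1:
  fixes p r n k :: nat
    and C :: "'a::nontriv mod_ring fls vec set"
  assumes "prime p" and "r \<ge> 1" and "CARD('a) = p ^ r"
    and "free_conv_code n k C"
  shows "catastrophic_code n C \<longleftrightarrow> catastrophic_code n (dual_code n C)"
proof -
  interpret nilpotent_local_ring "of_nat p :: 'a mod_ring" "r - 1"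
    by (rule mod_ring_nilpotent_local[OF assms(1-3)])
  \<comment> \<open>One direction is the contrapositive for \<open>C\<close>; the other applies the
    same lemma to the dual and returns to \<open>C\<close> by the double dual.\<close>
  show ?thesis
    using not_catastrophic_dual_code[of n C] not_catastrophic_dual_code[of n "dual_code n C"]
      dual_dual_code[OF assms(4)] by auto
qed

end
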